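(* Let $n\ge 2$ be even and let $\mathcal{JD}_n(q)=\sum_{\pi\in J_n^D}q^{\mathrm{inv}_D(\pi)}$. If $n/2$ is even, then the coefficients of the even powers of $q$ in $\mathcal{JD}_n(q)$ are symmetric and unimodal. If $n/2$ is odd, then the coefficients of the odd powers of $q$ in $\mathcal{JD}_n(q)$ are symmetric and unimodal.
   Context: $S_n^B$ is the group of all bijections $\pi$ of $\{\pm1,\dots,\pm n\}$ with $\pi(-a)=-\pi(a)$ for all $a$ (signed permutations). $S_n^D$ is the subgroup of those $\pi\in S_n^B$ for which $|\{1\le i\le n:\pi(i)<0\}|$ is even. For $\pi\in S_n^D$, $$\mathrm{inv}_D(\pi)=|\{(i,j):1\le i<j\le n,\ \pi(i)>\pi(j)\}|+|\{(i,j):1\le i<j\le n,\ \pi(i)+\pi(j)<0\}|.$$ $I_n^D=\{\pi\in S_n^D:\pi^2=\mathrm{id}\}$ and $J_n^D=\{\pi\in I_n^D:\pi(i)\ne\pm i\text{ for all }1\le i\le n\}$. The coefficients of the even (resp. odd) powers of $q$ are regarded as the finite sequence $a_0,a_1,\dots,a_m$ of coefficients of $q^{s},q^{s+2},\dots,q^{s+2m}$, where $s$ and $s+2m$ are the smallest and largest even (resp. odd) exponents occurring with non-zero coefficient. Such a sequence is symmetric if $a_j=a_{m-j}$ for all $j$, and unimodal if $a_0\le a_1\le\dots\le a_k\ge a_{k+1}\ge\dots\ge a_m$ for some $k$. *)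

theory Defs
  imports "HOL-Combinatorics.Permutations" "HOL-Computational_Algebra.Polynomial"
begin

text \<open>
  A bijection of \<open>{\<plusminus>1, \<dots>, \<plusminus>n}\<close> is represented by the function on all integers that
  extends it by the identity; this is what \<open>permutes\<close> expresses, so each bijection has exactly one
  representative and \<open>\<pi> \<circ> \<pi> = id\<close> says precisely that \<open>\<pi>\<close> is an involution.
\<close>

definition signed_range :: "nat \<Rightarrow> int set" where
  "signed_range n = {- int n..int n} - {0}"

definition S_B :: "nat \<Rightarrow> (int \<Rightarrow> int) set" where
  "S_B n = {\<pi>. \<pi> permutes signed_range n \<and> (\<forall>a\<in>signed_range n. \<pi> (- a) = - \<pi> a)}"

definition S_D :: "nat \<Rightarrow> (int \<Rightarrow> int) set" where
  "S_D n = {\<pi>\<in>S_B n. even (card {i\<in>{1..int n}. \<pi> i < 0})}"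

definition inv_D :: "nat \<Rightarrow> (int \<Rightarrow> int) \<Rightarrow> nat" where
  "inv_D n \<pi> =
     card {(i, j). 1 \<le> i \<and> i < j \<and> j \<le> int n \<and> \<pi> i > \<pi> j} +
     card {(i, j). 1 \<le> i \<and> i < j \<and> j \<le> int n \<and> \<pi> i + \<pi> j < 0}"

definition I_D :: "nat \<Rightarrow> (int \<Rightarrow> int) set" where
  "I_D n = {\<pi>\<in>S_D n. \<pi> \<circ> \<pi> = id}"

definition J_D :: "nat \<Rightarrow> (int \<Rightarrow> int) set" where
  "J_D n = {\<pi>\<in>I_D n. \<forall>i\<in>{1..int n}. \<pi> i \<noteq> i \<and> \<pi> i \<noteq> - i}"

lemma finite_J_D: "finite (J_D n)"
proof (rule finite_subset)
  show "J_D n \<subseteq> {\<pi>. \<pi> permutes signed_range n}"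
    by (auto simp: J_D_def I_D_def S_D_def S_B_def)
  show "finite {\<pi>. \<pi> permutes signed_range n}"
    by (simp add: finite_permutations signed_range_def)
qed

definition JD :: "nat \<Rightarrow> int poly" where
  "JD n = (\<Sum>\<pi>\<in>J_D n. monom 1 (inv_D n \<pi>))"

text \<open>
  For \<open>P\<close> one of \<^const>\<open>even\<close>, \<^const>\<open>odd\<close>: the coefficients of
  \<open>q^s, q^(s+2), \<dots>, q^(s+2m)\<close>, where \<open>s\<close> and \<open>s+2m\<close> are the smallest and largest
  exponents satisfying \<open>P\<close> that occur in \<open>p\<close>; the empty list if there are none.
\<close>

definition parity_coeffs :: "(nat \<Rightarrow> bool) \<Rightarrow> int poly \<Rightarrow> int list" where
  "parity_coeffs P p =
     (let E = {k. P k \<and> coeff p k \<noteq> 0} in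
      if E = {} then []
      else map (\<lambda>j. coeff p (Min E + 2 * j)) [0..<Suc ((Max E - Min E) div 2)])"

definition symmetric_seq :: "int list \<Rightarrow> bool" where
  "symmetric_seq a \<longleftrightarrow> (\<forall>j<length a. a ! j = a ! (length a - 1 - j))"

text \<open>The peak index \<open>k\<close> must exist, so the empty list does not count as unimodal.\<close>

definition unimodal_seq :: "int list \<Rightarrow> bool" where
  "unimodal_seq a \<longleftrightarrow>
     (\<exists>k<length a. (\<forall>j<k. a ! j \<le> a ! Suc j) \<and>
                   (\<forall>j. k \<le> j \<and> Suc j < length a \<longrightarrow> a ! j \<ge> a ! Suc j))"

end

theory Submission
  imports Defs
begin

text \<open>
  Write \<open>n = 2m\<close>. An element of \<open>J_D n\<close> is a perfect matching of \<open>{1..n}\<close> in which every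
  arc carries a sign: \<open>i\<close> and \<open>j\<close> are matched when \<open>\<pi> i = j\<close> or \<open>\<pi> i = - j\<close>. The negative
  values come in pairs, so the parity condition of type D holds automatically. The theorem follows
  from the product formula (\<open>JD_product_formula\<close>)
    \<open>JD (2m) = q^m \<Prod>i<m. (1 + q^(4i)) (1 + q^2 + q^4 + \<dots> + q^(4i))\<close>.

  The formula comes from deleting the arc at the largest point \<open>n\<close>. The deletion lowers the
  inversion number by an amount that depends only on the value \<open>\<pi> n\<close>, not on the rest of the
  matching (\<open>inv_on_remove_max_arc\<close>): the amount is \<open>2(n - j) - 1\<close> if \<open>\<pi> n = j > 0\<close>, and
  \<open>2(n - 2 + j) - 1\<close> if \<open>\<pi> n = - j < 0\<close>. Summing over the \<open>2(n - 1)\<close> possible values gives one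
  factor of the product. To avoid renumbering the remaining points, the argument runs over
  matchings of arbitrary finite sets of positive integers; their generating function turns out
  to depend on the cardinality only (\<open>sum_monom_inv_on_signed_matchings\<close>).

  With \<open>x = q^2\<close>, each factor is the interval \<open>1 + x + \<dots> + x^(4i)\<close> with its middle term
  doubled, so its coefficients are symmetric and unimodal. Products of polynomials with symmetric
  and unimodal coefficients have the same property (\<open>centred_unimodal_mult\<close>). Finally, the shift by
  \<open>q^m\<close> shows that all exponents of \<open>JD (2m)\<close> have the parity of \<open>m\<close>, which is why the
  theorem looks at even exponents for even \<open>m\<close> and at odd exponents for odd \<open>m\<close>.
\<close>

section \<open>Polynomials with coefficients unimodal about a centre\<close>

text \<open>
  Indexing the coefficients by all integers lets \<open>i \<mapsto> d - i\<close> act on indices as a genuine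
  reflection, without boundary cases or truncated subtraction.
\<close>

definition int_coeff :: "'a::zero poly \<Rightarrow> int \<Rightarrow> 'a" where
  "int_coeff p i = (if i < 0 then 0 else coeff p (nat i))"

text \<open>
  The centre of symmetry is \<open>d / 2\<close>. For \<open>a \<le> b\<close>, the inequality \<open>a + b \<le> d\<close> says that \<open>a\<close> is
  at least as far from the centre as \<open>b\<close>, so the second condition compares indices on opposite
  sides of the centre as well. Comparison with an index far to the left, where the coefficient
  is zero, shows that all coefficients are non-negative.
\<close>

definition centred_unimodal :: "int \<Rightarrow> int poly \<Rightarrow> bool" where
  "centred_unimodal d p \<longleftrightarrow>
     (\<forall>i. int_coeff p (d - i) = int_coeff p i) \<and>
     (\<forall>a b. a \<le> b \<longrightarrow> a + b \<le> d \<longrightarrow> int_coeff p a \<le> int_coeff p b)"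

text \<open>
  The window of summation may be any interval that contains the support of \<open>q\<close>; it can
  therefore be chosen invariant under a prescribed reflection.
\<close>

lemma int_coeff_mult:
  fixes p q :: "'a::comm_semiring_0 poly"
  assumes "l \<le> 0" and "int (degree q) \<le> u"
  shows "int_coeff (p * q) t = (\<Sum>j\<in>{l..u}. int_coeff q j * int_coeff p (t - j))"
proof -
  have "int_coeff (p * q) t = (\<Sum>j\<in>{0..t}. int_coeff q j * int_coeff p (t - j))"
  proof (cases "t < 0")
    case False
    then obtain n where n: "t = int n" by (metis nonneg_int_cases not_less)
    have "int_coeff (p * q) t = (\<Sum>i\<le>n. coeff q i * coeff p (n - i))"
      by (simp add: n int_coeff_def mult.commute[of p q] coeff_mult)
    also have "\<dots> = (\<Sum>j\<in>{0..t}. int_coeff q j * int_coeff p (t - j))"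
      by (rule sum.reindex_bij_witness[where i = nat and j = int])
         (auto simp: n int_coeff_def nat_diff_distrib)
    finally show ?thesis .
  qed (simp add: int_coeff_def)
  also have "\<dots> = (\<Sum>j\<in>{min 0 l..max t u}. int_coeff q j * int_coeff p (t - j))"
    by (rule sum.mono_neutral_left) (auto simp: int_coeff_def)
  also have "\<dots> = (\<Sum>j\<in>{l..u}. int_coeff q j * int_coeff p (t - j))"
    using assms by (intro sum.mono_neutral_right) (auto simp: int_coeff_def coeff_eq_0)
  finally show ?thesis .
qed

text \<open>
  Let \<open>f\<close> and \<open>g\<close> be the coefficient functions of \<open>p\<close> and \<open>q\<close>. The difference of the
  coefficients of \<open>p q\<close> at \<open>b\<close> and \<open>a\<close> is the sum of \<open>g j * h j\<close>, where
  \<open>h j = f (b - j) - f (a - j)\<close>. By the symmetry of \<open>f\<close>, the function \<open>h\<close> changes sign under the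
  reflection \<open>j \<mapsto> r - j\<close> with \<open>r = a + b - d\<close>. Averaging the sum with its reflection
  turns twice the difference into the sum of \<open>(g j - g (r - j)) * h j\<close>. As \<open>r \<le> e\<close>, both
  factors have the same sign: both are non-negative for \<open>2 j \<ge> r\<close> and non-positive otherwise.
\<close>

lemma centred_unimodal_mult:
  assumes p: "centred_unimodal d p" and q: "centred_unimodal e q"
  shows "centred_unimodal (d + e) (p * q)"
  unfolding centred_unimodal_def
proof (intro conjI allI impI)
  define f where "f = int_coeff p"
  define g where "g = int_coeff q"
  have f_sym: "f (d - i) = f i" and g_sym: "g (e - i) = g i" for i
    using p q by (auto simp: centred_unimodal_def f_def g_def)
  fix i
  \<comment> \<open>The window \<open>{e - R..R}\<close> is invariant under \<open>j \<mapsto> e - j\<close> and contains the support of \<open>q\<close>.\<close>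
  define R where "R = int (degree q) + \<bar>e\<bar>"
  have "int_coeff (p * q) (d + e - i) = (\<Sum>j\<in>{e - R..R}. g j * f (d + e - i - j))"
    unfolding f_def g_def by (rule int_coeff_mult) (auto simp: R_def)
  also have "\<dots> = (\<Sum>j\<in>{e - R..R}. g j * f (i - j))"
  proof (rule sum.reindex_bij_witness[where i = "\<lambda>j. e - j" and j = "\<lambda>j. e - j"])
    fix j
    have "f (i - (e - j)) = f (d + e - i - j)"
      using f_sym[of "i - (e - j)"] by (simp add: algebra_simps)
    then show "g (e - j) * f (i - (e - j)) = g j * f (d + e - i - j)" by (simp add: g_sym)
  qed auto
  also have "\<dots> = int_coeff (p * q) i"
    unfolding f_def g_def by (rule int_coeff_mult[symmetric]) (auto simp: R_def)
  finally show "int_coeff (p * q) (d + e - i) = int_coeff (p * q) i" .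
next
  define f where "f = int_coeff p"
  define g where "g = int_coeff q"
  have f_sym: "f (d - i) = f i" for i
    using p by (auto simp: centred_unimodal_def f_def)
  have f_mono: "f a \<le> f b" if "a \<le> b" "a + b \<le> d" for a b
    using p that by (auto simp: centred_unimodal_def f_def)
  have g_mono: "g a \<le> g b" if "a \<le> b" "a + b \<le> e" for a b
    using q that by (auto simp: centred_unimodal_def g_def)

  fix a b :: int
  assume ab: "a \<le> b" "a + b \<le> d + e"
  define r where "r = a + b - d"
  define R where "R = int (degree q) + \<bar>r\<bar>"
  define h where "h j = f (b - j) - f (a - j)" for j
  have conv: "int_coeff (p * q) t = (\<Sum>j\<in>{r - R..R}. g j * f (t - j))" for t
    unfolding f_def g_def by (rule int_coeff_mult) (auto simp: R_def)
  have h_anti: "h (r - j) = - h j" for j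
    using f_sym[of "b - (r - j)"] f_sym[of "a - (r - j)"]
    by (simp add: h_def r_def algebra_simps)
  have "(\<Sum>j\<in>{r - R..R}. g (r - j) * h (r - j)) = (\<Sum>j\<in>{r - R..R}. g j * h j)"
    by (rule sum.reindex_bij_witness[where i = "\<lambda>j. r - j" and j = "\<lambda>j. r - j"]) auto
  then have "2 * (\<Sum>j\<in>{r - R..R}. g j * h j) = (\<Sum>j\<in>{r - R..R}. (g j - g (r - j)) * h j)"
    by (simp add: h_anti sum_negf left_diff_distrib sum_subtractf)
  also have "\<dots> \<ge> 0"
  proof (rule sum_nonneg)
    fix j
    show "0 \<le> (g j - g (r - j)) * h j"
    proof (cases "r \<le> 2 * j")
      case True
      then have "g (r - j) \<le> g j" "0 \<le> h j"
        using g_mono[of "r - j" j] f_mono[of "a - j" "b - j"] ab by (auto simp: h_def r_def)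
      then show ?thesis by simp
    next
      case False
      then have "g j \<le> g (r - j)" "0 \<le> h (r - j)"
        using g_mono[of j "r - j"] f_mono[of "a - (r - j)" "b - (r - j)"] ab
        by (auto simp: h_def r_def)
      then show ?thesis by (simp add: h_anti mult_nonpos_nonpos)
    qed
  qed
  finally have "0 \<le> (\<Sum>j\<in>{r - R..R}. g j * h j)" by simp
  also have "\<dots> = int_coeff (p * q) b - int_coeff (p * q) a"
    by (simp add: conv h_def right_diff_distrib sum_subtractf)
  finally show "int_coeff (p * q) a \<le> int_coeff (p * q) b" by simp
qed

lemma centred_unimodal_1: "centred_unimodal 0 1"
  by (auto simp: centred_unimodal_def int_coeff_def)

lemma centred_unimodal_prod:
  assumes "finite I" and "\<And>i. i \<in> I \<Longrightarrow> centred_unimodal (d i) (p i)"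
  shows "centred_unimodal (sum d I) (prod p I)"
  using assms
  by (induction I rule: finite_induct) (auto simp: centred_unimodal_1 intro: centred_unimodal_mult)

lemma coeff_pcompose_monom_2:
  "coeff (pcompose p (monom 1 2)) k = (if even k then coeff p (k div 2) else 0)"
  for p :: "'a::comm_semiring_1 poly"
proof (induction p arbitrary: k)
  case (pCons a p)
  show ?case
  proof (cases "k < 2")
    case True
    then have "k = 0 \<or> k = 1" by auto
    then show ?thesis by (auto simp: pcompose_pCons coeff_monom_mult coeff_pCons)
  next
    case False
    then obtain l where "k = Suc (Suc l)" by (metis One_nat_def add_2_eq_Suc le_Suc_ex not_less)
    then show ?thesis
      by (simp add: pcompose_pCons coeff_monom_mult pCons.IH coeff_pCons)
  qed
qed simp

text \<open>
  The non-zero coefficient at \<open>0\<close> guarantees, together with the symmetry, that the smallest and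
  largest exponents of \<open>q^s p(q^2)\<close> are exactly \<open>s\<close> and \<open>s + 2 d\<close>. Hence the extracted
  sequence is the coefficient sequence of \<open>p\<close> from \<open>0\<close> to \<open>d\<close>, with its peak at \<open>d div 2\<close>.
\<close>

lemma parity_coeffs_centred_unimodal:
  fixes p :: "int poly" and P :: "nat \<Rightarrow> bool" and d s :: nat
  assumes p: "centred_unimodal (int d) p" and p0: "coeff p 0 \<noteq> 0"
    and P: "\<And>t. P (s + 2 * t)"
  defines "a \<equiv> parity_coeffs P (monom 1 s * pcompose p (monom 1 2))"
  shows "symmetric_seq a \<and> unimodal_seq a"
proof -
  have int_coeff: "int_coeff p (int i) = coeff p i" for i by (simp add: int_coeff_def)
  have p_sym: "int_coeff p (int d - i) = int_coeff p i" for i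
    using p by (simp add: centred_unimodal_def)
  have sym: "coeff p (d - i) = coeff p i" if "i \<le> d" for i
    using p_sym[of "int i"] that by (simp add: int_coeff flip: of_nat_diff)
  have mono: "coeff p i \<le> coeff p j" if "i \<le> j" "i + j \<le> d" for i j
  proof -
    have "int_coeff p (int i) \<le> int_coeff p (int j)"
      using p that by (auto simp: centred_unimodal_def)
    then show ?thesis by (simp add: int_coeff)
  qed
  have zero: "coeff p i = 0" if "i > d" for i
    using p_sym[of "int i"] that by (simp add: int_coeff) (simp add: int_coeff_def)
  define Q where "Q = monom 1 s * pcompose p (monom 1 2)"
  have Q: "coeff Q k = (if s \<le> k \<and> even (k - s) then coeff p ((k - s) div 2) else 0)" for k
    by (simp add: Q_def coeff_monom_mult coeff_pcompose_monom_2)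
  define E where "E = {k. P k \<and> coeff Q k \<noteq> 0}"
  have E_range: "s \<le> k \<and> k \<le> s + 2 * d" if "k \<in> E" for k
  proof -
    from that have "s \<le> k" "even (k - s)" "coeff p ((k - s) div 2) \<noteq> 0"
      by (auto simp: E_def Q split: if_splits)
    then obtain l where "k = s + 2 * l" "coeff p l \<noteq> 0"
      by (metis dvd_mult_div_cancel le_add_diff_inverse)
    with zero[of l] show ?thesis by (cases "l > d") auto
  qed
  have fin: "finite E"
    by (rule finite_subset[of _ "{..s + 2 * d}"]) (use E_range in auto)
  have "s \<in> E" "s + 2 * d \<in> E"
    using P[of 0] P[of d] p0 sym[of 0] by (auto simp: E_def Q)
  then have "Min E = s" "Max E = s + 2 * d" "E \<noteq> {}"
    using E_range fin by (auto intro!: Min_eqI Max_eqI)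
  then have "a = map (\<lambda>j. coeff Q (s + 2 * j)) [0..<Suc d]"
    unfolding a_def parity_coeffs_def Q_def[symmetric] E_def[symmetric] Let_def by simp
  then have a: "a = map (coeff p) [0..<Suc d]" by (simp add: Q)
  have nth: "a ! j = coeff p j" if "j \<le> d" for j
    using that by (simp add: a nth_append)
  have len: "length a = Suc d" by (simp add: a)
  have "symmetric_seq a"
    using sym by (auto simp: symmetric_seq_def len nth less_Suc_eq_le)
  moreover have "unimodal_seq a"
    unfolding unimodal_seq_def
  proof (intro exI[of _ "d div 2"] conjI allI impI)
    fix j assume "d div 2 \<le> j \<and> Suc j < length a"
    \<comment> \<open>Past the peak, the indices are reflected into the increasing half.\<close>
    then have "coeff p (d - Suc j) \<le> coeff p (d - j)" "Suc j \<le> d"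
      by (auto simp: len intro!: mono)
    then show "a ! Suc j \<le> a ! j" by (simp add: nth sym)
  qed (auto simp: len nth intro!: mono)
  ultimately show ?thesis ..
qed

section \<open>Signed perfect matchings of a finite set\<close>

text \<open>
  The set \<open>A\<close> of positive integers is the set of matched points; \<open>\<pi>\<close> acts on \<open>A\<close> and \<open>- A\<close>
  and is extended by the identity, like the signed permutations.
\<close>

definition signed_matchings :: "int set \<Rightarrow> (int \<Rightarrow> int) set" where
  "signed_matchings A =
     {\<pi>. (\<forall>a. \<pi> (\<pi> a) = a) \<and> (\<forall>a. \<pi> (- a) = - \<pi> a) \<and> (\<forall>a. \<bar>a\<bar> \<notin> A \<longrightarrow> \<pi> a = a) \<and>
         (\<forall>a\<in>A. \<bar>\<pi> a\<bar> \<noteq> a)}"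

definition pair_inv :: "(int \<Rightarrow> int) \<Rightarrow> int \<Rightarrow> int \<Rightarrow> nat" where
  "pair_inv \<pi> a b = of_bool (a < b \<and> \<pi> a > \<pi> b) + of_bool (a < b \<and> \<pi> a + \<pi> b < 0)"

definition inv_on :: "int set \<Rightarrow> (int \<Rightarrow> int) \<Rightarrow> nat" where
  "inv_on A \<pi> = (\<Sum>a\<in>A. \<Sum>b\<in>A. pair_inv \<pi> a b)"

text \<open>
  The signed transposition with arc \<open>N \<mapsto> k\<close>, where \<open>k\<close> may be negative. Composition with it
  adds this arc to a matching that avoids its end points, and removes it from a matching that
  contains it.
\<close>

definition signed_swap :: "int \<Rightarrow> int \<Rightarrow> int \<Rightarrow> int" where
  "signed_swap N k a =
     (if a = N then k else if a = - N then - k else if a = k then N else if a = - k then - N else a)"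

text \<open>
  Forgetting signs, \<open>a \<mapsto> \<bar>\<pi> a\<bar>\<close> is an ordinary involution of \<open>A\<close>.
\<close>

lemma abs_signed_matching:
  assumes "\<pi> \<in> signed_matchings A" and "\<And>a. a \<in> A \<Longrightarrow> 0 < a"
  shows "\<bar>\<pi> \<bar>a\<bar>\<bar> = \<bar>\<pi> a\<bar>" and "\<bar>\<pi> \<bar>\<pi> a\<bar>\<bar> = \<bar>a\<bar>" and "\<bar>a\<bar> \<in> A \<Longrightarrow> \<bar>\<pi> a\<bar> \<in> A"
    and "\<bar>\<pi> a\<bar> = \<bar>\<pi> b\<bar> \<longleftrightarrow> \<bar>a\<bar> = \<bar>b\<bar>"
proof -
  have inv: "\<pi> (\<pi> a) = a" and odd: "\<pi> (- a) = - \<pi> a" and out: "\<bar>a\<bar> \<notin> A \<Longrightarrow> \<pi> a = a" for a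
    using assms(1) by (auto simp: signed_matchings_def)
  show 1: "\<bar>\<pi> \<bar>a\<bar>\<bar> = \<bar>\<pi> a\<bar>" for a
    by (cases "a < 0") (simp_all add: odd)
  show 2: "\<bar>\<pi> \<bar>\<pi> a\<bar>\<bar> = \<bar>a\<bar>" for a
    using 1[of "\<pi> a"] by (simp add: inv)
  show "\<bar>\<pi> a\<bar> \<in> A" if "\<bar>a\<bar> \<in> A"
    using out[of "\<pi> a"] inv[of a] that by metis
  show "\<bar>\<pi> a\<bar> = \<bar>\<pi> b\<bar> \<longleftrightarrow> \<bar>a\<bar> = \<bar>b\<bar>"
    using 1[of a] 1[of b] 2[of a] 2[of b] by metis
qed

lemma finite_signed_matchings:
  assumes "finite A"
  shows "finite (signed_matchings A)"
proof (rule finite_subset)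
  have "\<pi> permutes {a. \<bar>a\<bar> \<in> A}" if "\<pi> \<in> signed_matchings A" for \<pi>
    unfolding permutes_def using that by (auto simp: signed_matchings_def) metis+
  then show "signed_matchings A \<subseteq> {\<pi>. \<pi> permutes {a. \<bar>a\<bar> \<in> A}}" by auto
  have "{a. \<bar>a\<bar> \<in> A} \<subseteq> A \<union> uminus ` A" by (force simp: abs_if split: if_splits)
  then have "finite {a. \<bar>a\<bar> \<in> A}" using assms by (simp add: finite_subset)
  then show "finite {\<pi>. \<pi> permutes {a. \<bar>a\<bar> \<in> A}}" by (rule finite_permutations)
qed

lemma inv_on_insert:
  assumes "finite A" and "x \<notin> A"
  shows "inv_on (insert x A) \<pi> = inv_on A \<pi> + (\<Sum>a\<in>A. pair_inv \<pi> a x + pair_inv \<pi> x a)"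
  using assms by (simp add: inv_on_def sum.distrib pair_inv_def[of _ x x] algebra_simps)

text \<open>
  The arc from the largest point \<open>N\<close> to \<open>k\<close> contributes \<open>1 + 2 * arc_weight C k\<close> to the
  inversion number, where \<open>C\<close> is the set of the other points. Since \<open>C\<close> contains \<open>\<bar>k\<bar>\<close>, the number
  \<open>card C - 1\<close> counts the points outside the arc.
\<close>

definition arc_weight :: "int set \<Rightarrow> int \<Rightarrow> nat" where
  "arc_weight C k =
     (if k > 0 then card {b\<in>C. k < b} else card C - 1 + card {b\<in>C. b < - k})"

lemma signed_swap_signed_swap:
  assumes "N \<noteq> 0" "k \<noteq> 0"
  shows "signed_swap N k (signed_swap N k a) = a"
  using assms by (auto simp: signed_swap_def)

lemma compose_signed_swap_adds_arc:
  assumes "\<And>b. b \<in> B \<Longrightarrow> 0 < b" and "\<sigma> \<in> signed_matchings B" and "0 < N"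
    and "k \<noteq> 0" and "N \<noteq> \<bar>k\<bar>" and "N \<notin> B" and "\<bar>k\<bar> \<notin> B"
  shows "\<sigma> \<circ> signed_swap N k \<in> signed_matchings (insert N (insert \<bar>k\<bar> B))"
    and "(\<sigma> \<circ> signed_swap N k) N = k"
proof -
  have inv: "\<sigma> (\<sigma> a) = a" and odd: "\<sigma> (- a) = - \<sigma> a" and out: "\<bar>a\<bar> \<notin> B \<Longrightarrow> \<sigma> a = a"
    and fpf: "a \<in> B \<Longrightarrow> \<bar>\<sigma> a\<bar> \<noteq> a" for a
    using assms(2) by (auto simp: signed_matchings_def)
  have fixed: "\<sigma> N = N" "\<sigma> (- N) = - N" "\<sigma> k = k" "\<sigma> (- k) = - k"
    using assms by (auto intro!: out)
  have eq: "\<sigma> a = b \<longleftrightarrow> a = \<sigma> b" for a b using inv by metis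
  show "(\<sigma> \<circ> signed_swap N k) N = k" by (simp add: signed_swap_def fixed)
  show "\<sigma> \<circ> signed_swap N k \<in> signed_matchings (insert N (insert \<bar>k\<bar> B))"
    unfolding signed_matchings_def
  proof (intro CollectI conjI allI ballI impI)
    fix a show "(\<sigma> \<circ> signed_swap N k) ((\<sigma> \<circ> signed_swap N k) a) = a"
      using fixed assms(3-5) by (auto simp: signed_swap_def inv eq)
  next
    fix a show "(\<sigma> \<circ> signed_swap N k) (- a) = - (\<sigma> \<circ> signed_swap N k) a"
      using fixed assms(3-5) by (auto simp: signed_swap_def odd)
  next
    fix a assume "\<bar>a\<bar> \<notin> insert N (insert \<bar>k\<bar> B)"
    then show "(\<sigma> \<circ> signed_swap N k) a = a"
      using assms(3) by (auto simp: signed_swap_def out)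
  next
    fix a assume "a \<in> insert N (insert \<bar>k\<bar> B)"
    then consider "a = N" | "a = \<bar>k\<bar>" | "a \<in> B" by auto
    then show "\<bar>(\<sigma> \<circ> signed_swap N k) a\<bar> \<noteq> a"
      using assms fixed fpf[of a] assms(1)[of a] by cases (auto simp: signed_swap_def abs_if split: if_splits)
  qed
qed

lemma compose_signed_swap_removes_arc:
  assumes "\<And>b. b \<in> A \<Longrightarrow> 0 < b" and "\<pi> \<in> signed_matchings A" and "N \<in> A" and "\<pi> N = k"
  shows "\<pi> \<circ> signed_swap N k \<in> signed_matchings (A - {N, \<bar>k\<bar>})"
proof -
  have inv: "\<pi> (\<pi> a) = a" and odd: "\<pi> (- a) = - \<pi> a" and out: "\<bar>a\<bar> \<notin> A \<Longrightarrow> \<pi> a = a"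
    and fpf: "a \<in> A \<Longrightarrow> \<bar>\<pi> a\<bar> \<noteq> a" for a
    using assms(2) by (auto simp: signed_matchings_def)
  have v: "\<pi> N = k" "\<pi> k = N" "\<pi> (- N) = - k" "\<pi> (- k) = - N"
    using inv[of N] assms(4) by (auto simp: odd)
  have N: "0 < N" "N \<noteq> \<bar>k\<bar>" using assms fpf[of N] by auto
  have eq: "\<pi> a = b \<longleftrightarrow> a = \<pi> b" for a b using inv by metis
  show ?thesis
    unfolding signed_matchings_def
  proof (intro CollectI conjI allI ballI impI)
    fix a show "(\<pi> \<circ> signed_swap N k) ((\<pi> \<circ> signed_swap N k) a) = a"
      using N v by (auto simp: signed_swap_def inv eq)
  next
    fix a show "(\<pi> \<circ> signed_swap N k) (- a) = - (\<pi> \<circ> signed_swap N k) a"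
      using N v by (auto simp: signed_swap_def odd)
  next
    fix a assume "\<bar>a\<bar> \<notin> A - {N, \<bar>k\<bar>}"
    then show "(\<pi> \<circ> signed_swap N k) a = a"
      using N v by (auto simp: signed_swap_def out abs_if split: if_splits)
  next
    fix a assume "a \<in> A - {N, \<bar>k\<bar>}"
    then show "\<bar>(\<pi> \<circ> signed_swap N k) a\<bar> \<noteq> a"
      using N assms(1)[of a] fpf[of a] by (auto simp: signed_swap_def)
  qed
qed

lemma sum_of_bool_card: "finite A \<Longrightarrow> (\<Sum>a\<in>A. of_bool (P a)) = card {a\<in>A. P a}"
  by (simp add: Int_def)

text \<open>
  Put \<open>j = \<bar>k\<bar>\<close> and let \<open>B\<close> be the set of the remaining points. For each \<open>a \<in> B\<close>, the pair formed
  with position \<open>j\<close> contributes an amount that depends only on whether \<open>a < j\<close>, because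
  \<open>\<bar>\<pi> j\<bar> = N\<close> exceeds \<open>\<bar>\<pi> a\<bar>\<close>. The pair \<open>(a, N)\<close> contributes an amount that depends only on
  whether \<open>\<bar>\<pi> a\<bar> < j\<close>. As \<open>\<bar>\<pi>\<bar>\<close> permutes \<open>B\<close>, both sums over \<open>B\<close> agree up to reindexing:
  each is the number of \<open>a > j\<close> for a positive arc, and \<open>card B\<close> plus the number of \<open>a < j\<close> for a
  negative arc. The pair \<open>(j, N)\<close> itself contributes \<open>1\<close>.
\<close>

lemma inv_on_remove_max_arc:
  fixes A :: "int set"
  assumes fin: "finite A" and pos: "\<And>b. b \<in> A \<Longrightarrow> 0 < b" and max: "\<And>b. b \<in> A \<Longrightarrow> b \<le> N"
    and N: "N \<in> A" and pi: "\<pi> \<in> signed_matchings A" and k: "\<pi> N = k"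
  shows "inv_on A \<pi> =
           inv_on (A - {N, \<bar>k\<bar>}) (\<pi> \<circ> signed_swap N k) + (1 + 2 * arc_weight (A - {N}) k)"
proof -
  have inv: "\<pi> (\<pi> a) = a" and odd: "\<pi> (- a) = - \<pi> a" and fpf: "a \<in> A \<Longrightarrow> \<bar>\<pi> a\<bar> \<noteq> a" for a
    using pi by (auto simp: signed_matchings_def)
  note ab = abs_signed_matching[OF pi pos]
  define j where "j = \<bar>k\<bar>"
  define B where "B = A - {N, j}"
  have j: "j \<in> A" "j \<noteq> N" "0 < j" "j < N"
    using ab(3)[of N] fpf[OF N] pos[of 0] pos[OF N] N k max[of "\<bar>\<pi> N\<bar>"]
    by (auto simp: j_def order_less_le)
  have finB: "finite B" and A: "A = insert N (insert j B)" and C: "A - {N} = insert j B"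
    and notin: "j \<notin> B" "N \<notin> insert j B" using fin N j by (auto simp: B_def)
  have B: "0 < b" "b < N" "b \<noteq> j" "b \<noteq> N" "\<bar>\<pi> b\<bar> < N" "\<bar>\<pi> b\<bar> \<noteq> j" "\<bar>\<pi> b\<bar> \<in> B" if "b \<in> B" for b
  proof -
    have b: "b \<in> A" "b \<noteq> N" "b \<noteq> j" "0 < b" using that pos by (auto simp: B_def)
    show "0 < b" "b < N" "b \<noteq> j" "b \<noteq> N" using b max[of b] by auto
    have "\<bar>\<pi> b\<bar> \<in> A" using ab(3)[of b] b by simp
    moreover have "\<bar>\<pi> b\<bar> \<noteq> j" using ab(4)[of b N] b k pos[OF N] by (auto simp: j_def)
    moreover have "\<bar>\<pi> b\<bar> \<noteq> N"
      using ab(4)[of b k] b inv[of N] k pos[OF N] by (auto simp: j_def)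
    ultimately show "\<bar>\<pi> b\<bar> < N" "\<bar>\<pi> b\<bar> \<noteq> j" "\<bar>\<pi> b\<bar> \<in> B"
      using max[of "\<bar>\<pi> b\<bar>"] by (auto simp: B_def)
  qed
  have reindex: "(\<Sum>a\<in>B. f \<bar>\<pi> a\<bar>) = sum f B" for f :: "int \<Rightarrow> nat"
    by (rule sum.reindex_bij_witness[where i = "\<lambda>a. \<bar>\<pi> a\<bar>" and j = "\<lambda>a. \<bar>\<pi> a\<bar>"])
       (use B(1,7) ab(2) in \<open>auto simp: abs_of_pos\<close>)
  have same: "inv_on B \<pi> = inv_on B (\<pi> \<circ> signed_swap N k)"
  proof -
    have "signed_swap N k a = a" if "a \<in> B" for a
      using B(1-4)[OF that] j(3) by (auto simp: signed_swap_def j_def)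
    then show ?thesis by (simp add: inv_on_def pair_inv_def)
  qed
  have "inv_on A \<pi> = inv_on B \<pi> + (\<Sum>a\<in>B. pair_inv \<pi> a j + pair_inv \<pi> j a)
      + (pair_inv \<pi> j N + pair_inv \<pi> N j) + (\<Sum>a\<in>B. pair_inv \<pi> a N + pair_inv \<pi> N a)"
    unfolding A using finB notin by (simp add: inv_on_insert)
  moreover have "(\<Sum>a\<in>B. pair_inv \<pi> a j + pair_inv \<pi> j a)
      + (pair_inv \<pi> j N + pair_inv \<pi> N j) + (\<Sum>a\<in>B. pair_inv \<pi> a N + pair_inv \<pi> N a)
      = 1 + 2 * arc_weight (A - {N}) k"
  proof (cases "k > 0")
    case True
    then have kj: "k = j" "\<pi> N = j" "\<pi> j = N" using k inv[of N] by (auto simp: j_def)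
    have "(\<Sum>a\<in>B. pair_inv \<pi> a j + pair_inv \<pi> j a) = (\<Sum>a\<in>B. of_bool (j < a))"
    proof (intro sum.cong refl)
      fix a assume "a \<in> B"
      from B[OF this] show "pair_inv \<pi> a j + pair_inv \<pi> j a = of_bool (j < a)"
        by (auto simp: pair_inv_def kj of_bool_def)
    qed
    moreover have "(\<Sum>a\<in>B. pair_inv \<pi> a N + pair_inv \<pi> N a) = (\<Sum>a\<in>B. of_bool (j < \<bar>\<pi> a\<bar>))"
    proof (intro sum.cong refl)
      fix a assume "a \<in> B"
      from B[OF this] j show "pair_inv \<pi> a N + pair_inv \<pi> N a = of_bool (j < \<bar>\<pi> a\<bar>)"
        by (auto simp: pair_inv_def kj of_bool_def)
    qed
    moreover have "pair_inv \<pi> j N + pair_inv \<pi> N j = 1"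
      using j by (simp add: pair_inv_def kj)
    moreover have "{b\<in>insert j B. j < b} = {b\<in>B. j < b}" by auto
    then have "arc_weight (A - {N}) k = card {b\<in>B. j < b}"
      unfolding C using True by (simp add: arc_weight_def kj)
    ultimately show ?thesis
      by (simp only: reindex[of "\<lambda>a. of_bool (j < a)"] sum_of_bool_card[OF finB])
  next
    case False
    then have kj: "k = - j" "\<pi> N = - j" "\<pi> j = - N"
      using k inv[of N] odd[of k] by (auto simp: j_def)
    have "(\<Sum>a\<in>B. pair_inv \<pi> a j + pair_inv \<pi> j a) = (\<Sum>a\<in>B. 1 + of_bool (a < j))"
    proof (intro sum.cong refl)
      fix a assume "a \<in> B"
      from B[OF this] show "pair_inv \<pi> a j + pair_inv \<pi> j a = 1 + of_bool (a < j)"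
        by (auto simp: pair_inv_def kj of_bool_def)
    qed
    moreover have "(\<Sum>a\<in>B. pair_inv \<pi> a N + pair_inv \<pi> N a) = (\<Sum>a\<in>B. 1 + of_bool (\<bar>\<pi> a\<bar> < j))"
    proof (intro sum.cong refl)
      fix a assume "a \<in> B"
      from B[OF this] j show "pair_inv \<pi> a N + pair_inv \<pi> N a = 1 + of_bool (\<bar>\<pi> a\<bar> < j)"
        by (auto simp: pair_inv_def kj of_bool_def)
    qed
    moreover have "pair_inv \<pi> j N + pair_inv \<pi> N j = 1"
      using j by (simp add: pair_inv_def kj)
    moreover have "{b\<in>insert j B. b < j} = {b\<in>B. b < j}" by auto
    then have "arc_weight (A - {N}) k = card B + card {b\<in>B. b < j}"
      unfolding C using False finB notin by (simp add: arc_weight_def kj)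
    moreover have "(\<Sum>a\<in>B. 1 + of_bool (a < j)) = card B + card {b\<in>B. b < j}"
      by (simp only: sum.distrib sum_of_bool_card[OF finB]) simp
    ultimately show ?thesis
      by (simp only: reindex[of "\<lambda>a. 1 + of_bool (a < j)"]) simp
  qed
  ultimately show ?thesis using same by (simp add: B_def j_def)
qed

section \<open>The product formula\<close>

text \<open>
  The first sum belongs to the positive arcs at the largest of \<open>2 m + 2\<close> points, the second
  to the negative arcs. In closed form this is \<open>(1 + x^(2m)) (1 + x + \<dots> + x^(2m))\<close>.
\<close>

definition partner_poly :: "nat \<Rightarrow> int poly" where
  "partner_poly m = (\<Sum>i<2*m+1. monom 1 i) + (\<Sum>i<2*m+1. monom 1 (2 * m + i))"

text \<open>
  The number of larger elements runs through \<open>0, \<dots>, card C - 1\<close> as \<open>j\<close> runs through \<open>C\<close>.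
\<close>

lemma sum_card_greater:
  fixes C :: "'a::linorder set"
  assumes "finite C"
  shows "(\<Sum>j\<in>C. f (card {b\<in>C. j < b})) = (\<Sum>i<card C. f i)"
  using assms
proof (induction C rule: finite_linorder_min_induct)
  case (insert x C)
  have "{b\<in>insert x C. j < b} = {b\<in>C. j < b}" if "j \<in> C" for j using insert that by auto
  moreover have "{b\<in>insert x C. x < b} = C" using insert by auto
  ultimately show ?case using insert by (auto simp: add.commute)
qed simp

lemma sum_card_less:
  fixes C :: "'a::linorder set"
  assumes "finite C"
  shows "(\<Sum>j\<in>C. f (card {b\<in>C. b < j})) = (\<Sum>i<card C. f i)"
  using assms
proof (induction C rule: finite_linorder_max_induct)
  case (insert x C)
  have "{b\<in>insert x C. b < j} = {b\<in>C. b < j}" if "j \<in> C" for j using insert that by auto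
  moreover have "{b\<in>insert x C. b < x} = C" using insert by auto
  ultimately show ?case using insert by (auto simp: add.commute)
qed simp

lemma sum_abs_in:
  fixes C :: "int set"
  assumes "finite C" and "\<And>c. c \<in> C \<Longrightarrow> 0 < c"
  shows "(\<Sum>k | \<bar>k\<bar> \<in> C. f k) = (\<Sum>j\<in>C. f j) + (\<Sum>j\<in>C. f (- j))"
proof -
  have "{k. \<bar>k\<bar> \<in> C} = C \<union> uminus ` C"
    using assms(2) by (force simp: abs_if split: if_splits)
  moreover have "C \<inter> uminus ` C = {}" using assms(2) by (auto dest!: assms(2))
  moreover have "(\<Sum>k\<in>uminus ` C. f k) = (\<Sum>j\<in>C. f (- j))"
    by (subst sum.reindex) (auto simp: inj_on_def)
  ultimately show ?thesis using assms(1) by (simp add: sum.union_disjoint)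
qed

lemma sum_monom_arc_weight:
  assumes "finite C" and pos: "\<And>c. c \<in> C \<Longrightarrow> 0 < c" and "card C = 2 * m + 1"
  shows "(\<Sum>k | \<bar>k\<bar> \<in> C. monom 1 (arc_weight C k)) = partner_poly m"
proof -
  have "(\<Sum>j\<in>C. monom 1 (arc_weight C j)) = (\<Sum>j\<in>C. monom (1::int) (card {b\<in>C. j < b}))"
    using pos by (intro sum.cong) (auto simp: arc_weight_def)
  moreover have "(\<Sum>j\<in>C. monom 1 (arc_weight C (- j)))
      = (\<Sum>j\<in>C. monom (1::int) (2 * m + card {b\<in>C. b < j}))"
    using pos assms(3) by (intro sum.cong) (auto simp: arc_weight_def dest!: pos)
  ultimately show ?thesis
    using assms by (simp only: sum_abs_in partner_poly_def sum_card_greater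
        sum_card_less[where f = "\<lambda>i. monom 1 (2 * m + i)"])
qed

text \<open>
  The intervals \<open>{0..2m}\<close> and \<open>{2m..4m}\<close> of exponents overlap in \<open>2m\<close> only, so the polynomial
  is \<open>1 + x + \<dots> + x^(4m)\<close> with the middle term doubled.
\<close>

lemma int_coeff_partner_poly:
  "int_coeff (partner_poly m) t = of_bool (0 \<le> t \<and> t \<le> 4 * int m) + of_bool (t = 2 * int m)"
proof (cases "t < 0")
  case False
  define n where "n = nat t"
  have t: "t = int n" using False by (simp add: n_def)
  have 1: "coeff (\<Sum>i<2*m+1. monom (1::int) i) n = of_bool (n \<le> 2 * m)"
    by (simp add: coeff_sum coeff_monom)
  have "coeff (\<Sum>i<2*m+1. monom (1::int) (2 * m + i)) n = (\<Sum>i<2*m+1. if 2 * m + i = n then 1 else 0)"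
    by (simp only: coeff_sum coeff_monom)
  also have "\<dots> = (\<Sum>i<2*m+1. if i = n - 2 * m \<and> 2 * m \<le> n then 1 else 0)"
    by (intro sum.cong) auto
  also have "\<dots> = of_bool (2 * m \<le> n \<and> n \<le> 4 * m)"
    by (cases "2 * m \<le> n") auto
  finally show ?thesis
    using 1 by (auto simp: int_coeff_def partner_poly_def t)
qed (simp add: int_coeff_def)

lemma centred_unimodal_partner_poly: "centred_unimodal (4 * int m) (partner_poly m)"
  unfolding centred_unimodal_def int_coeff_partner_poly by (auto simp: of_bool_def)

text \<open>
  Induction on the number of arcs. The matchings of \<open>A\<close> are grouped by the partner \<open>k\<close> of the
  maximum \<open>N\<close>; composition with \<open>signed_swap N k\<close> identifies each group with the matchings of the
  remaining points and changes the inversion number by a constant. Those sets of remaining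
  points differ with \<open>k\<close> but all have the same cardinality, so every group contributes a power of
  \<open>q\<close> times the same polynomial \<open>G\<close>.
\<close>

lemma sum_monom_inv_on_signed_matchings:
  fixes A :: "int set"
  assumes "finite A" and "\<And>a. a \<in> A \<Longrightarrow> 0 < a" and "card A = 2 * m"
  shows "(\<Sum>\<pi>\<in>signed_matchings A. monom 1 (inv_on A \<pi>)) =
           monom 1 m * pcompose (\<Prod>i<m. partner_poly i) (monom 1 2)"
  using assms
proof (induction m arbitrary: A)
  case 0
  then have "A = {}" by simp
  moreover have "signed_matchings {} = {id}" by (auto simp: signed_matchings_def)
  ultimately show ?case by (simp add: inv_on_def pcompose_1)
next
  case (Suc m)
  note fin = Suc.prems(1) and pos = Suc.prems(2)
  define N where "N = Max A"
  have "A \<noteq> {}" using Suc.prems(3) by auto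
  then have N: "N \<in> A" and max: "\<And>b. b \<in> A \<Longrightarrow> b \<le> N" using fin by (auto simp: N_def)
  define C where "C = A - {N}"
  have C: "finite C" "\<And>c. c \<in> C \<Longrightarrow> 0 < c" "card C = 2 * m + 1"
    using fin pos N Suc.prems(3) by (auto simp: C_def)
  define K where "K = {k. \<bar>k\<bar> \<in> C}"
  have "K \<subseteq> C \<union> uminus ` C" by (force simp: K_def abs_if split: if_splits)
  then have finK: "finite K" using C(1) by (simp add: finite_subset)
  define G where "G = monom 1 m * pcompose (\<Prod>i<m. partner_poly i) (monom 1 2)"
  have piN: "(\<lambda>\<pi>. \<pi> N) ` signed_matchings A \<subseteq> K"
  proof
    fix k assume "k \<in> (\<lambda>\<pi>. \<pi> N) ` signed_matchings A"
    then obtain \<pi> where \<pi>: "\<pi> \<in> signed_matchings A" "k = \<pi> N" by auto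
    then have "\<bar>k\<bar> \<noteq> N" using N by (auto simp: signed_matchings_def)
    moreover have "\<bar>k\<bar> \<in> A" using abs_signed_matching(3)[OF \<pi>(1) pos, of N] N pos[OF N] \<pi>(2) by simp
    ultimately show "k \<in> K" by (simp add: K_def C_def)
  qed
  have fibre: "(\<Sum>\<pi>\<in>{\<pi>\<in>signed_matchings A. \<pi> N = k}. monom 1 (inv_on A \<pi>))
      = monom 1 (1 + 2 * arc_weight C k) * G" if "k \<in> K" for k
  proof -
    define B where "B = A - {N, \<bar>k\<bar>}"
    have k: "\<bar>k\<bar> \<in> A" "\<bar>k\<bar> \<noteq> N" "k \<noteq> 0" "0 < N"
      using that pos[of 0] pos[OF N] by (auto simp: K_def C_def)
    have A: "insert N (insert \<bar>k\<bar> B) = A" using k N by (auto simp: B_def)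
    have B: "finite B" "\<And>b. b \<in> B \<Longrightarrow> 0 < b" "N \<notin> B" "\<bar>k\<bar> \<notin> B"
      using fin pos by (auto simp: B_def)
    have "card B = 2 * m"
      using Suc.prems(3) B k unfolding A[symmetric] by simp
    then have G: "(\<Sum>\<sigma>\<in>signed_matchings B. monom 1 (inv_on B \<sigma>)) = G"
      unfolding G_def using Suc.IH B by blast
    have "(\<Sum>\<pi>\<in>{\<pi>\<in>signed_matchings A. \<pi> N = k}. monom (1::int) (inv_on A \<pi>))
        = (\<Sum>\<sigma>\<in>signed_matchings B. monom 1 (inv_on B \<sigma> + (1 + 2 * arc_weight C k)))"
    proof (rule sum.reindex_bij_witness[where i = "\<lambda>\<sigma>. \<sigma> \<circ> signed_swap N k"
          and j = "\<lambda>\<pi>. \<pi> \<circ> signed_swap N k"])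
      fix \<sigma> assume "\<sigma> \<in> signed_matchings B"
      then show "\<sigma> \<circ> signed_swap N k \<in> {\<pi>\<in>signed_matchings A. \<pi> N = k}"
        using compose_signed_swap_adds_arc[of B \<sigma> N k] B k unfolding A by simp
    next
      fix \<pi> assume \<pi>: "\<pi> \<in> {\<pi>\<in>signed_matchings A. \<pi> N = k}"
      then show "\<pi> \<circ> signed_swap N k \<in> signed_matchings B"
        unfolding B_def using compose_signed_swap_removes_arc[of A \<pi> N k] pos N by simp
      show "monom 1 (inv_on B (\<pi> \<circ> signed_swap N k) + (1 + 2 * arc_weight C k))
          = monom 1 (inv_on A \<pi>)"
        unfolding B_def C_def using inv_on_remove_max_arc[of A N \<pi> k] fin pos max N \<pi> by simp
    qed (use k in \<open>auto simp: signed_swap_signed_swap\<close>)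
    also have "\<dots> = monom 1 (1 + 2 * arc_weight C k) * (\<Sum>\<sigma>\<in>signed_matchings B. monom 1 (inv_on B \<sigma>))"
      by (simp add: sum_distrib_left mult_monom add.commute)
    finally show ?thesis by (simp only: G)
  qed
  have sq: "pcompose (monom 1 i) (monom 1 2) = monom (1::int) (2 * i)" for i
    by (rule poly_eqI) (auto simp: coeff_pcompose_monom_2 coeff_monom elim!: oddE)
  have "(\<Sum>\<pi>\<in>signed_matchings A. monom 1 (inv_on A \<pi>))
      = (\<Sum>k\<in>K. \<Sum>\<pi>\<in>{\<pi>\<in>signed_matchings A. \<pi> N = k}. monom 1 (inv_on A \<pi>))"
    by (rule sum.group[OF finite_signed_matchings[OF fin] finK piN, symmetric])
  also have "\<dots> = (\<Sum>k\<in>K. monom 1 (1 + 2 * arc_weight C k)) * G"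
    by (simp add: fibre sum_distrib_right)
  also have "(\<Sum>k\<in>K. monom (1::int) (1 + 2 * arc_weight C k))
      = monom 1 1 * pcompose (\<Sum>k\<in>K. monom 1 (arc_weight C k)) (monom 1 2)"
    by (simp add: pcompose_sum sq sum_distrib_left mult_monom)
  also have "(\<Sum>k\<in>K. monom 1 (arc_weight C k)) = partner_poly m"
    unfolding K_def using C by (rule sum_monom_arc_weight)
  also have "monom 1 1 * pcompose (partner_poly m) (monom 1 2) * G
      = (monom 1 1 * monom 1 m) * pcompose (partner_poly m * (\<Prod>i<m. partner_poly i)) (monom 1 2)"
    unfolding G_def pcompose_mult by (simp only: ac_simps)
  also have "\<dots> = monom 1 (Suc m) * pcompose (\<Prod>i<Suc m. partner_poly i) (monom 1 2)"
    by (simp add: mult_monom mult.commute)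
  finally show ?case .
qed

section \<open>Signed permutations of type D\<close>

lemma even_card_involution:
  fixes X :: "'a::linorder set"
  assumes "finite X" and "\<And>x. x \<in> X \<Longrightarrow> f x \<in> X" and "\<And>x. x \<in> X \<Longrightarrow> f (f x) = x"
    and "\<And>x. x \<in> X \<Longrightarrow> f x \<noteq> x"
  shows "even (card X)"
proof -
  define Y where "Y = {x\<in>X. x < f x}"
  have "X = Y \<union> f ` Y"
  proof
    show "X \<subseteq> Y \<union> f ` Y"
    proof
      fix x assume x: "x \<in> X"
      show "x \<in> Y \<union> f ` Y"
      proof (cases "x < f x")
        case False
        then have "f x \<in> Y" using assms(2-4)[OF x] by (simp add: Y_def)
        then show ?thesis using assms(3)[OF x] by (metis UnI2 image_eqI)
      qed (use x in \<open>simp add: Y_def\<close>)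
    qed
  qed (use assms(2) in \<open>auto simp: Y_def\<close>)
  moreover have "Y \<inter> f ` Y = {}" using assms(3) by (force simp: Y_def)
  moreover have "card (f ` Y) = card Y"
    by (rule card_image) (metis (mono_tags, lifting) CollectD Y_def assms(3) inj_on_def)
  moreover have "finite Y" using assms(1) by (simp add: Y_def)
  ultimately have "card X = card Y + card Y" by (metis card_Un_disjoint finite_imageI)
  then show ?thesis by simp
qed

text \<open>
  The even number of negative values, required in type D, is automatic: \<open>i \<mapsto> - \<pi> i\<close> is an
  involution without fixed points on the set of \<open>i > 0\<close> with \<open>\<pi> i < 0\<close>.
\<close>

lemma J_D_eq_signed_matchings: "J_D n = signed_matchings {1..int n}"
proof (intro equalityI subsetI)
  have range: "a \<in> signed_range n \<longleftrightarrow> \<bar>a\<bar> \<in> {1..int n}" for a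
    by (auto simp: signed_range_def)
  fix \<pi>
  show "\<pi> \<in> signed_matchings {1..int n}" if "\<pi> \<in> J_D n"
  proof -
    have perm: "\<pi> permutes signed_range n" and odd: "\<And>a. a \<in> signed_range n \<Longrightarrow> \<pi> (- a) = - \<pi> a"
      and inv: "\<pi> \<circ> \<pi> = id" and fpf: "\<And>i. i \<in> {1..int n} \<Longrightarrow> \<pi> i \<noteq> i \<and> \<pi> i \<noteq> - i"
      using that by (auto simp: J_D_def I_D_def S_D_def S_B_def)
    have out: "\<pi> a = a" if "\<bar>a\<bar> \<notin> {1..int n}" for a
      using perm that range by (auto simp: permutes_def)
    show ?thesis
      unfolding signed_matchings_def
    proof (intro CollectI conjI allI ballI impI)
      fix a show "\<pi> (\<pi> a) = a" using inv by (metis comp_apply id_apply)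
    next
      fix a show "\<pi> (- a) = - \<pi> a"
        using odd[of a] out[of a] out[of "- a"] range[of a] by fastforce
    next
      fix a assume "a \<in> {1..int n}" then show "\<bar>\<pi> a\<bar> \<noteq> a" using fpf[of a] by auto
    qed (rule out)
  qed
  show "\<pi> \<in> J_D n" if "\<pi> \<in> signed_matchings {1..int n}"
  proof -
    have inv: "\<pi> (\<pi> a) = a" and odd: "\<pi> (- a) = - \<pi> a"
      and out: "\<bar>a\<bar> \<notin> {1..int n} \<Longrightarrow> \<pi> a = a"
      and fpf: "a \<in> {1..int n} \<Longrightarrow> \<bar>\<pi> a\<bar> \<noteq> a" for a
      using that by (auto simp: signed_matchings_def)
    have clo: "\<bar>\<pi> a\<bar> \<in> {1..int n}" if "\<bar>a\<bar> \<in> {1..int n}" for a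
      using abs_signed_matching(3)[OF \<open>\<pi> \<in> signed_matchings _\<close> _ that] by simp
    have "\<pi> permutes signed_range n"
      unfolding permutes_def using inv out range by metis
    moreover have "even (card {i\<in>{1..int n}. \<pi> i < 0})"
    proof (rule even_card_involution[where f = "\<lambda>i. - \<pi> i"])
      fix i assume i: "i \<in> {i\<in>{1..int n}. \<pi> i < 0}"
      then show "- \<pi> i \<in> {i\<in>{1..int n}. \<pi> i < 0}" using clo[of i] by (auto simp: odd inv)
      show "- \<pi> i \<noteq> i" using i fpf[of i] by auto
    next
      show "finite {i\<in>{1..int n}. \<pi> i < 0}" by (rule finite_subset[of _ "{1..int n}"]) auto
    qed (auto simp: odd inv)
    moreover have "\<pi> \<circ> \<pi> = id" using inv by auto
    moreover have "\<pi> i \<noteq> i \<and> \<pi> i \<noteq> - i" if "i \<in> {1..int n}" for i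
      using fpf[OF that] that by auto
    ultimately show ?thesis by (auto simp: J_D_def I_D_def S_D_def S_B_def odd)
  qed
qed

lemma inv_D_eq_inv_on: "inv_D n \<pi> = inv_on {1..int n} \<pi>"
proof -
  have "card {(i, j). 1 \<le> i \<and> i < j \<and> j \<le> int n \<and> P i j}
      = (\<Sum>a\<in>{1..int n}. \<Sum>b\<in>{1..int n}. of_bool (a < b \<and> P a b))" for P
  proof -
    have "{(i, j). 1 \<le> i \<and> i < j \<and> j \<le> int n \<and> P i j}
        = {x\<in>{1..int n} \<times> {1..int n}. fst x < snd x \<and> P (fst x) (snd x)}" by auto
    also have "card \<dots> = (\<Sum>x\<in>{1..int n} \<times> {1..int n}. of_bool (fst x < snd x \<and> P (fst x) (snd x)))"
      by (rule sum_of_bool_card[symmetric]) simp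
    also have "\<dots> = (\<Sum>a\<in>{1..int n}. \<Sum>b\<in>{1..int n}. of_bool (a < b \<and> P a b))"
      by (simp only: sum.cartesian_product case_prod_unfold)
    finally show ?thesis .
  qed
  from this[of "\<lambda>i j. \<pi> i > \<pi> j"] this[of "\<lambda>i j. \<pi> i + \<pi> j < 0"] show ?thesis
    by (simp only: inv_D_def inv_on_def pair_inv_def sum.distrib)
qed

lemma JD_product_formula:
  "JD (2 * m) = monom 1 m * pcompose (\<Prod>i<m. partner_poly i) (monom 1 2)"
  using sum_monom_inv_on_signed_matchings[of "{1..int (2 * m)}" m]
  by (simp add: JD_def J_D_eq_signed_matchings inv_D_eq_inv_on)

theorem theorem3p4:
  fixes n :: nat
  assumes "n \<ge> 2" and "even n"
  shows "(even (n div 2) \<longrightarrow>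
            symmetric_seq (parity_coeffs even (JD n)) \<and> unimodal_seq (parity_coeffs even (JD n))) \<and>
         (odd (n div 2) \<longrightarrow>
            symmetric_seq (parity_coeffs odd (JD n)) \<and> unimodal_seq (parity_coeffs odd (JD n)))"
proof -
  define m where "m = n div 2"
  define p where "p = (\<Prod>i<m. partner_poly i)"
  have JD: "JD n = monom 1 m * pcompose p (monom 1 2)"
    using assms(2) JD_product_formula[of m] by (simp add: m_def p_def)
  have "centred_unimodal (\<Sum>i<m. 4 * int i) p"
    unfolding p_def by (intro centred_unimodal_prod centred_unimodal_partner_poly) simp
  then have p: "centred_unimodal (int (\<Sum>i<m. 4 * i)) p" by simp
  have "poly (partner_poly i) 0 \<noteq> 0" for i
    using int_coeff_partner_poly[of i 0] by (simp add: int_coeff_def poly_0_coeff_0)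
  then have "poly p 0 \<noteq> 0" by (simp add: p_def poly_prod)
  then have p0: "coeff p 0 \<noteq> 0" by (simp only: poly_0_coeff_0 not_False_eq_True)
  show ?thesis
    using parity_coeffs_centred_unimodal[OF p p0, of even m]
      parity_coeffs_centred_unimodal[OF p p0, of odd m]
    by (simp add: JD m_def[symmetric])
qed

end
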